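(* Let $M = (\mathcal P, \mathcal B)$ be a (finite) Möbius plane of even order $q>2$. Let $\mathcal F \subseteq \mathcal B$ be an intersecting family. Then $|\mathcal F| \leq q(q+1)$. Equality occurs if and only if $\mathcal F$ consists of all circles through a point of $\mathcal P$, i.e. if and only if there is a point $P \in \mathcal P$ with $\mathcal F = \{ c \in \mathcal B : P \in c \}$.
   Context: All incidence structures are finite. An incidence structure $(\mathcal P, \mathcal B)$ consists of a set $\mathcal P$ of points and a set $\mathcal B$ of subsets of $\mathcal P$, here called circles. For a point $P \in \mathcal P$, the residue at $P$ is the incidence structure with point set $\mathcal P \setminus \{P\}$ and with lines the sets $c \setminus \{P\}$, for $c \in \mathcal B$ with $P \in c$. A Möbius plane is an incidence structure $(\mathcal P,\mathcal B)$ such that the residue at each point is an affine plane. Characteristic properties: any three distinct points lie on a unique circle; and given two distinct points $P$ and $Q$ and a circle $c$ through $P$ but not through $Q$, there is a unique circle through $P$ and $Q$ which intersects $c$ only in $P$. The affine planes arising as residues all have the same order $q$, which is called the order of the Möbius plane; then every circle has $q+1$ points, every point lies on $q(q+1)$ circles, $|\mathcal P| = q^2+1$ and $|\mathcal B| = q(q^2+1)$. A family $\mathcal F \subseteq \mathcal B$ is intersecting if any two of its members have at least one point in common. *)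

theory Defs
  imports Main
begin

locale incidence_structure =
  fixes points :: "'a set" and blocks :: "'a set set"
  assumes finite_points: "finite points"
    and blocks_subset: "blocks \<subseteq> Pow points"

locale affine_plane = incidence_structure points lines
  for points :: "'a set" and lines :: "'a set set" +
  assumes unique_line:
      "\<lbrakk>P \<in> points; Q \<in> points; P \<noteq> Q\<rbrakk> \<Longrightarrow> \<exists>!l. l \<in> lines \<and> P \<in> l \<and> Q \<in> l"
    and unique_parallel:
      "\<lbrakk>l \<in> lines; P \<in> points; P \<notin> l\<rbrakk> \<Longrightarrow> \<exists>!m. m \<in> lines \<and> P \<in> m \<and> m \<inter> l = {}"
    and non_collinear:
      "\<exists>P\<in>points. \<exists>Q\<in>points. \<exists>R\<in>points.
         P \<noteq> Q \<and> P \<noteq> R \<and> Q \<noteq> R \<and> \<not> (\<exists>l\<in>lines. P \<in> l \<and> Q \<in> l \<and> R \<in> l)"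

definition affine_plane_of_order :: "'a set \<Rightarrow> 'a set set \<Rightarrow> nat \<Rightarrow> bool" where
  "affine_plane_of_order points lines q \<longleftrightarrow>
     affine_plane points lines \<and> (\<forall>l\<in>lines. card l = q)"

definition residue_points :: "'a set \<Rightarrow> 'a \<Rightarrow> 'a set" where
  "residue_points points P = points - {P}"

definition residue_lines :: "'a set set \<Rightarrow> 'a \<Rightarrow> 'a set set" where
  "residue_lines circles P = {c - {P} | c. c \<in> circles \<and> P \<in> c}"

text \<open>
  The residues do not see an empty point set or an empty circle.  Both are excluded
  explicitly, so that the order is well defined and every circle has one point more
  than the order.
\<close>

locale moebius_plane = incidence_structure points circles
  for points :: "'a set" and circles :: "'a set set" +
  assumes points_nonempty: "points \<noteq> {}"
    and circles_nonempty: "{} \<notin> circles"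
    and residue_affine:
      "P \<in> points \<Longrightarrow> affine_plane (residue_points points P) (residue_lines circles P)"

definition moebius_plane_of_order :: "'a set \<Rightarrow> 'a set set \<Rightarrow> nat \<Rightarrow> bool" where
  "moebius_plane_of_order points circles q \<longleftrightarrow>
     moebius_plane points circles \<and>
     (\<forall>P\<in>points. affine_plane_of_order (residue_points points P) (residue_lines circles P) q)"

definition intersecting :: "'a set set \<Rightarrow> bool" where
  "intersecting F \<longleftrightarrow> pairwise (\<lambda>c d. c \<inter> d \<noteq> {}) F"

end

theory Submission
  imports Defs Complex_Main
begin

text \<open>
  Let \<open>f\<close> be the indicator function of the family \<open>F\<close> on the circles, \<open>m\<close> the size of \<open>F\<close>,
  \<open>a\<^sub>P\<close> the number of members of \<open>F\<close> through the point \<open>P\<close>, and \<open>s\<close> the sum of the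
  \<open>a\<^sub>P\<^sup>2\<close>.  The proof is an eigenvalue argument, carried out with explicit sums of squares.

  Even order enters through one fact.  Let \<open>P\<close> lie off a circle \<open>d\<close>, and consider a pencil of
  circles that touch each other at \<open>P\<close>.  The pencil partitions the points other than \<open>P\<close>,
  each of its members meets \<open>d\<close> in at most two points, and \<open>d\<close> has the odd number \<open>q + 1\<close> of
  points; so some member is tangent to \<open>d\<close>.  There are \<open>q + 1\<close> pencils at \<open>P\<close> and \<open>q + 1\<close>
  tangents to \<open>d\<close> through \<open>P\<close>, so every pencil has exactly one
  (\<open>card_tangents_in_pencil\<close>).  It follows that the number of common tangents of two circles
  depends only on the size of their intersection (\<open>card_common_tangents\<close>).  Call two circles
  touching if they are equal or tangent, and let \<open>A\<close> be the matrix of this relation, \<open>N\<close> the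
  incidence matrix of circles and points, and \<open>J\<close> the all-one matrix; then
  \<open>A\<^sup>2 = q\<^sup>2 I + (q + 1) J - N N\<^sup>T\<close>.  So \<open>A\<close> can only have the eigenvalues \<open>q\<close> and \<open>-q\<close> on the
  kernel \<open>K\<close> of \<open>N\<^sup>T\<close>.  On the vectors of sum zero in the image of \<open>N\<close> it acts as \<open>-1\<close>,
  because a point \<open>P\<close> is on \<open>q\<close> or \<open>q + 1\<close> circles touching a given circle, according to whether
  \<open>P\<close> is on that circle (\<open>card_touching_through\<close>).

  Let \<open>g\<close> be the orthogonal projection of \<open>f\<close> to \<open>K\<close>.  For an intersecting family the
  squared norms of \<open>g\<close> and of \<open>A g - q g\<close> are functions of \<open>q\<close>, \<open>m\<close> and \<open>s\<close> alone, since
  two distinct members meet in one point if they are tangent and in two otherwise.  They turn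
  out to be multiples of \<open>m\<^sup>2 (q + 1) / q + (q\<^sup>2 - 1) m - s\<close> and of \<open>(q - 2) (s - 2 m\<^sup>2)\<close>
  (\<open>sum_point_deviation_squared\<close>, \<open>sum_tangent_deviation_squared\<close>).  Both are nonnegative, so
  \<open>2 m\<^sup>2 \<le> s \<le> m\<^sup>2 (q + 1) / q + (q\<^sup>2 - 1) m\<close>, which is \<open>m \<le> q (q + 1)\<close>.

  If \<open>m = q (q + 1)\<close>, then \<open>g = 0\<close>, that is, the sum of \<open>a\<^sub>P\<close> over the points of a circle
  depends only on whether the circle is in \<open>F\<close>.  Summing this over the circles through two points
  \<open>P\<close> and \<open>Q\<close> shows, modulo \<open>q\<close>, that \<open>F\<close> has one or all of these circles, and that
  \<open>a\<^sub>P + a\<^sub>Q\<close> is \<open>2 (q + 1)\<close> or \<open>(q + 1)\<^sup>2\<close> (\<open>deg_sum_of_extremal\<close>).  As \<open>(q + 1)\<^sup>2\<close> is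
  odd, comparing three points yields a point \<open>P\<close> with \<open>a\<^sub>P = q (q + 1)\<close>, and \<open>F\<close> consists of
  the circles through it.
\<close>

section \<open>Counting in a Moebius plane\<close>

locale moebius_plane_order =
  fixes points :: "'a set" and circles :: "'a set set" and q :: nat
  assumes order: "moebius_plane_of_order points circles q"
begin

lemma finite_pts: "finite points"
  and circles_sub: "c \<in> circles \<Longrightarrow> c \<subseteq> points"
  and circle_nonempty: "c \<in> circles \<Longrightarrow> c \<noteq> {}"
  and pts_nonempty: "points \<noteq> {}"
  and residue_plane: "P \<in> points \<Longrightarrow> affine_plane (points - {P}) (residue_lines circles P)"
proof -
  interpret moebius_plane points circles
    using order by (simp add: moebius_plane_of_order_def)
  show "finite points" by (rule finite_points)
  show "c \<in> circles \<Longrightarrow> c \<subseteq> points" using blocks_subset by blast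
  show "c \<in> circles \<Longrightarrow> c \<noteq> {}" using circles_nonempty by blast
  show "points \<noteq> {}" by (rule points_nonempty)
  show "P \<in> points \<Longrightarrow> affine_plane (points - {P}) (residue_lines circles P)"
    using residue_affine by (simp add: residue_points_def)
qed

lemma finite_circle: "c \<in> circles \<Longrightarrow> finite c"
  using finite_pts circles_sub finite_subset by blast

lemma finite_circles: "finite circles"
  using finite_pts circles_sub by (meson Pow_iff finite_Pow_iff finite_subset subsetI)

lemma card_circle: assumes "c \<in> circles" shows "card c = q + 1"
proof -
  obtain P where P: "P \<in> c" using circle_nonempty[OF assms] by blast
  hence "P \<in> points" using circles_sub assms by blast
  hence "\<forall>l\<in>residue_lines circles P. card l = q"
    using order by (auto simp: moebius_plane_of_order_def affine_plane_of_order_def)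
  hence "card (c - {P}) = q" using assms P by (auto simp: residue_lines_def simp del: card_Diff_insert)
  thus ?thesis using card_Suc_Diff1[OF finite_circle[OF assms] P] by simp
qed

lemma circle_exists:
  assumes "P \<in> points" "Q \<in> points" "R \<in> points" "P \<noteq> Q" "P \<noteq> R" "Q \<noteq> R"
  obtains c where "c \<in> circles" "P \<in> c" "Q \<in> c" "R \<in> c"
proof -
  interpret R: affine_plane "points - {P}" "residue_lines circles P"
    using residue_plane assms(1) .
  have "\<exists>l. l \<in> residue_lines circles P \<and> Q \<in> l \<and> R \<in> l"
    using R.unique_line[of Q R] assms by blast
  thus ?thesis using that by (auto simp: residue_lines_def)
qed

lemma circle_eqI:
  assumes "c \<in> circles" "d \<in> circles" "P \<noteq> Q" "P \<noteq> R" "Q \<noteq> R"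
    and "P \<in> c" "Q \<in> c" "R \<in> c" "P \<in> d" "Q \<in> d" "R \<in> d"
  shows "c = d"
proof -
  have pts: "P \<in> points" "Q \<in> points" "R \<in> points" using circles_sub assms by blast+
  interpret R: affine_plane "points - {P}" "residue_lines circles P"
    using residue_plane pts(1) .
  have "c - {P} \<in> residue_lines circles P" "d - {P} \<in> residue_lines circles P"
    using assms by (auto simp: residue_lines_def)
  hence "c - {P} = d - {P}"
    using R.unique_line[of Q R] assms pts by blast
  thus ?thesis using assms by blast
qed

lemma tangent_exists:
  assumes "c \<in> circles" "P \<in> c" "Q \<in> points" "Q \<notin> c"
  obtains d where "d \<in> circles" "Q \<in> d" "c \<inter> d = {P}"
proof -
  have P: "P \<in> points" using circles_sub assms by blast
  interpret R: affine_plane "points - {P}" "residue_lines circles P"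
    using residue_plane P .
  have "c - {P} \<in> residue_lines circles P" using assms by (auto simp: residue_lines_def)
  hence "\<exists>m. m \<in> residue_lines circles P \<and> Q \<in> m \<and> m \<inter> (c - {P}) = {}"
    using R.unique_parallel[of "c - {P}" Q] assms by blast
  then obtain d where d: "d \<in> circles" "P \<in> d" "Q \<in> d - {P}" "(d - {P}) \<inter> (c - {P}) = {}"
    unfolding residue_lines_def by blast
  have "Q \<in> d" "c \<inter> d = {P}" using d assms by blast+
  thus ?thesis using that d by blast
qed

lemma tangent_unique:
  assumes "c \<in> circles" "d \<in> circles" "e \<in> circles" "Q \<in> d" "Q \<in> e" "Q \<noteq> P"
    and "c \<inter> d = {P}" "c \<inter> e = {P}"
  shows "d = e"
proof -
  have P: "P \<in> points" "Q \<in> points" "P \<in> c" "P \<in> d" "P \<in> e" "Q \<notin> c"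
    using circles_sub assms by blast+
  interpret R: affine_plane "points - {P}" "residue_lines circles P"
    using residue_plane P(1) .
  have "c - {P} \<in> residue_lines circles P" "d - {P} \<in> residue_lines circles P"
    "e - {P} \<in> residue_lines circles P" using assms P by (auto simp: residue_lines_def)
  moreover have "(d - {P}) \<inter> (c - {P}) = {}" "(e - {P}) \<inter> (c - {P}) = {}" using assms by auto
  ultimately have "d - {P} = e - {P}"
    using R.unique_parallel[of "c - {P}" Q] assms P by blast
  thus ?thesis using P by blast
qed

lemma order_ge_2: "2 \<le> q"
proof -
  obtain P where P: "P \<in> points" using pts_nonempty by blast
  interpret R: affine_plane "points - {P}" "residue_lines circles P"
    using residue_plane P .
  obtain Q R where QR: "Q \<in> points - {P}" "R \<in> points - {P}" "Q \<noteq> R"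
    using R.non_collinear by blast
  obtain c where c: "c \<in> circles" "P \<in> c" "Q \<in> c" "R \<in> c"
    using circle_exists[of P Q R] P QR by auto
  have "card {P, Q, R} \<le> card c" using c finite_circle by (intro card_mono) auto
  thus ?thesis using QR card_circle[OF c(1)] by auto
qed

text \<open>
  Three points that are not collinear in the residue at \<open>P\<close> span three circles through \<open>P\<close>,
  and \<open>Q\<close> cannot lie on all three.
\<close>

lemma circle_avoiding_exists:
  assumes "P \<in> points" "Q \<in> points" "P \<noteq> Q"
  obtains c where "c \<in> circles" "P \<in> c" "Q \<notin> c"
proof -
  interpret R: affine_plane "points - {P}" "residue_lines circles P"
    using residue_plane assms(1) .
  obtain A B C where ABC: "A \<in> points - {P}" "B \<in> points - {P}" "C \<in> points - {P}"
    "A \<noteq> B" "A \<noteq> C" "B \<noteq> C" "\<not> (\<exists>l\<in>residue_lines circles P. A \<in> l \<and> B \<in> l \<and> C \<in> l)"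
    using R.non_collinear by blast
  have ABC': "\<not> (c \<in> circles \<and> P \<in> c \<and> A \<in> c \<and> B \<in> c \<and> C \<in> c)" for c
  proof
    assume "c \<in> circles \<and> P \<in> c \<and> A \<in> c \<and> B \<in> c \<and> C \<in> c"
    hence "c - {P} \<in> residue_lines circles P" "A \<in> c - {P}" "B \<in> c - {P}" "C \<in> c - {P}"
      using ABC by (auto simp: residue_lines_def)
    thus False using ABC(7) by (meson bexI)
  qed
  obtain c where c: "c \<in> circles" "P \<in> c" "A \<in> c" "B \<in> c"
    using circle_exists[of P A B] assms ABC by auto
  obtain d where d: "d \<in> circles" "P \<in> d" "A \<in> d" "C \<in> d"
    using circle_exists[of P A C] assms ABC by auto
  obtain e where e: "e \<in> circles" "P \<in> e" "B \<in> e" "C \<in> e"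
    using circle_exists[of P B C] assms ABC by auto
  show ?thesis
  proof (cases "Q \<in> c \<and> Q \<in> d \<and> Q \<in> e")
    case False
    thus ?thesis using that c d e by blast
  next
    case True
    (* c and d share P and A, so a further common point Q would make c = d. *)
    have "Q = A" 
      using circle_eqI[of c d P A Q] c d True ABC ABC' assms by blast
    hence "A \<in> e" using True by blast
    thus ?thesis using e ABC' by blast
  qed
qed

lemma card_Int_le_2:
  assumes "c \<in> circles" "d \<in> circles" "c \<noteq> d"
  shows "card (c \<inter> d) \<le> 2"
proof (rule ccontr)
  assume "\<not> ?thesis"
  hence "3 \<le> card (c \<inter> d)" by simp
  then obtain A where A: "A \<subseteq> c \<inter> d" "card A = 3" by (rule obtain_subset_with_card_n)
  then obtain P Q R where "A = {P, Q, R}" "P \<noteq> Q" "P \<noteq> R" "Q \<noteq> R"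
    by (auto simp: card_3_iff)
  thus False using circle_eqI[of c d P Q R] A assms by auto
qed

text \<open>
  Fix a circle \<open>c\<close> through \<open>P\<close> that misses \<open>Q\<close>.  A circle through \<open>P\<close> and \<open>Q\<close> corresponds to
  a point of \<open>c\<close>: its second intersection with \<open>c\<close>, or \<open>P\<close> itself for the tangent at \<open>P\<close>.
\<close>

lemma card_circles_through_2:
  assumes "P \<in> points" "Q \<in> points" "P \<noteq> Q"
  shows "card {c \<in> circles. P \<in> c \<and> Q \<in> c} = q + 1"
proof -
  obtain c where c: "c \<in> circles" "P \<in> c" "Q \<notin> c" using circle_avoiding_exists assms by metis
  let ?X = "{d \<in> circles. P \<in> d \<and> Q \<in> d}"
  have "\<exists>d. d \<in> ?X \<and> c \<inter> d = {P, R}" if R: "R \<in> c" for R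
  proof (cases "R = P")
    case True
    obtain d where "d \<in> circles" "Q \<in> d" "c \<inter> d = {P}"
      using tangent_exists[of c P Q] c assms by blast
    thus ?thesis using True by auto
  next
    case False
    then obtain d where d: "d \<in> circles" "P \<in> d" "Q \<in> d" "R \<in> d"
      using circle_exists[of P Q R] assms c R circles_sub by blast
    have "X = P \<or> X = R" if "X \<in> c" "X \<in> d" for X
      using circle_eqI[of c d P R X] c d that False R by blast
    hence "c \<inter> d = {P, R}" using c d R by blast
    thus ?thesis using d by blast
  qed
  then obtain f where f: "\<And>R. R \<in> c \<Longrightarrow> f R \<in> ?X" "\<And>R. R \<in> c \<Longrightarrow> c \<inter> f R = {P, R}"
    by metis
  have "inj_on f c" 
  proof (rule inj_onI)
    fix R S assume "R \<in> c" "S \<in> c" "f R = f S"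
    hence "{P, R} = {P, S}" using f(2) by metis
    thus "R = S" by (auto simp: doubleton_eq_iff)
  qed
  moreover have "f ` c = ?X"
  proof
    show "f ` c \<subseteq> ?X" using f by blast
    show "?X \<subseteq> f ` c"
    proof
      fix d assume d: "d \<in> ?X"
      hence "d \<noteq> c" using c by blast
      show "d \<in> f ` c"
      proof (cases "c \<inter> d = {P}")
        case True
        hence "d = f P" using tangent_unique[of c d "f P" Q P] f[of P] d c assms by auto
        thus ?thesis using c by blast
      next
        case False
        then obtain R where R: "R \<in> c" "R \<in> d" "R \<noteq> P" using c d by blast
        hence "d = f R" using circle_eqI[of d "f R" P Q R] f[of R] d c assms by blast
        thus ?thesis using R by blast
      qed
    qed
  qed
  ultimately have "card ?X = card c" by (metis card_image)
  thus ?thesis using card_circle c by simp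
qed

text \<open>
  The circles through \<open>P\<close> and \<open>Q\<close> partition the remaining points into \<open>q + 1\<close> sets of size
  \<open>q - 1\<close>.
\<close>

lemma card_points: "card points = q\<^sup>2 + 1"
proof -
  obtain P where P: "P \<in> points" using pts_nonempty by blast
  interpret R: affine_plane "points - {P}" "residue_lines circles P"
    using residue_plane P .
  obtain Q where Q: "Q \<in> points" "Q \<noteq> P" using R.non_collinear by blast
  let ?X = "{c \<in> circles. P \<in> c \<and> Q \<in> c}"
  have eq: "points - {P, Q} = (\<Union>c\<in>?X. c - {P, Q})"
  proof
    show "points - {P, Q} \<subseteq> (\<Union>c\<in>?X. c - {P, Q})"
    proof
      fix R assume "R \<in> points - {P, Q}"
      thus "R \<in> (\<Union>c\<in>?X. c - {P, Q})" using circle_exists[of P Q R] P Q by blast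
    qed
  qed (use circles_sub in blast)
  have "card (\<Union>c\<in>?X. c - {P, Q}) = (\<Sum>c\<in>?X. card (c - {P, Q}))"
  proof (rule card_UN_disjoint)
    show "finite ?X" using finite_circles by simp
    show "\<forall>c\<in>?X. finite (c - {P, Q})" using finite_circle by blast
    show "\<forall>c\<in>?X. \<forall>d\<in>?X. c \<noteq> d \<longrightarrow> (c - {P, Q}) \<inter> (d - {P, Q}) = {}"
    proof (intro ballI impI equals0I)
      fix c d R assume "c \<in> ?X" "d \<in> ?X" "c \<noteq> d" "R \<in> (c - {P, Q}) \<inter> (d - {P, Q})"
      thus False using circle_eqI[of c d P Q R] Q by blast
    qed
  qed
  also have "\<dots> = (\<Sum>c\<in>?X. q - 1)"
    by (intro sum.cong refl) (use Q in \<open>auto simp: card_circle card_Diff_subset\<close>)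
  also have "\<dots> = (q + 1) * (q - 1)" using card_circles_through_2 P Q by simp
  finally have "card (points - {P, Q}) = (q + 1) * (q - 1)" using eq by simp
  moreover have "card (points - {P, Q}) = card points - 2"
    using P Q by (subst card_Diff_subset) auto
  moreover have "card {P, Q} \<le> card points" using P Q finite_pts by (intro card_mono) auto
  ultimately have "card points = (q + 1) * (q - 1) + 2" using Q by auto
  thus ?thesis using order_ge_2 by (cases q) (auto simp: power2_eq_square)
qed

end

section \<open>Tangent circles in even order\<close>

lemma double_count:
  assumes "finite A" "finite B"
  shows "(\<Sum>a\<in>A. card {b \<in> B. R a b}) = (\<Sum>b\<in>B. card {a \<in> A. R a b})"
proof -
  have "(\<Sum>a\<in>A. card {b \<in> B. R a b}) = (\<Sum>a\<in>A. \<Sum>b\<in>B. of_bool (R a b))"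
    using assms by (intro sum.cong) (auto simp: Int_def)
  also have "\<dots> = (\<Sum>b\<in>B. \<Sum>a\<in>A. of_bool (R a b))" by (rule sum.swap)
  also have "\<dots> = (\<Sum>b\<in>B. card {a \<in> A. R a b})"
    using assms by (intro sum.cong) (auto simp: Int_def)
  finally show ?thesis .
qed

context moebius_plane_order
begin

lemma card_circles_through: 
  assumes "P \<in> points" shows "card {c \<in> circles. P \<in> c} = q * (q + 1)"
proof -
  let ?X = "{c \<in> circles. P \<in> c}"
  have "q * card ?X = (\<Sum>c\<in>?X. card {Q \<in> points - {P}. Q \<in> c})"
  proof -
    have "card {Q \<in> points - {P}. Q \<in> c} = q" if "c \<in> ?X" for c
    proof -
      have "{Q \<in> points - {P}. Q \<in> c} = c - {P}" using that circles_sub by blast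
      thus ?thesis using card_circle[of c] that by simp
    qed
    thus ?thesis by simp
  qed
  also have "\<dots> = (\<Sum>Q\<in>points - {P}. card {c \<in> ?X. Q \<in> c})"
    using finite_pts finite_circles by (intro double_count) auto
  also have "\<dots> = (\<Sum>Q\<in>points - {P}. q + 1)"
    using card_circles_through_2[OF assms] by (intro sum.cong) (auto simp: conj_assoc)
  also have "\<dots> = q\<^sup>2 * (q + 1)"
    using card_points assms finite_pts by simp
  finally have "q * card ?X = q * (q * (q + 1))"
    by (simp only: power2_eq_square mult.assoc)
  thus ?thesis using order_ge_2 by (simp only: mult_cancel1) auto
qed

lemma card_circles: "card circles = q * (q\<^sup>2 + 1)"
proof -
  have "(q + 1) * card circles = (\<Sum>c\<in>circles. card {P \<in> points. P \<in> c})"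
  proof -
    have "{P \<in> points. P \<in> c} = c" if "c \<in> circles" for c
      using that circles_sub by blast
    thus ?thesis using card_circle by simp
  qed
  also have "\<dots> = (\<Sum>P\<in>points. card {c \<in> circles. P \<in> c})"
    by (rule double_count[OF finite_circles finite_pts])
  also have "\<dots> = (q + 1) * (q * (q\<^sup>2 + 1))" 
    using card_circles_through card_points by (simp add: algebra_simps)
  finally show ?thesis by (simp only: mult_cancel1) simp
qed

text \<open>
  Counting every circle as touching itself makes the relation of touching at a fixed point an
  equivalence, and makes its square on all circles simplest.
\<close>

definition touch :: "'a set \<Rightarrow> 'a set \<Rightarrow> bool" where
  "touch c d \<longleftrightarrow> c = d \<or> card (c \<inter> d) = 1"

text \<open>
  In the residue at \<open>P\<close> this is the parallel class of the line \<open>c - {P}\<close>.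
\<close>

definition tangent_pencil :: "'a \<Rightarrow> 'a set \<Rightarrow> 'a set set" where
  "tangent_pencil P c = {d \<in> circles. P \<in> d \<and> (d = c \<or> c \<inter> d = {P})}"

lemma touch_sym: "touch c d \<longleftrightarrow> touch d c"
  by (auto simp: touch_def Int_commute)

lemma touch_iff_pencil:
  assumes "c \<in> circles" "d \<in> circles" "P \<in> c" "P \<in> d"
  shows "touch c d \<longleftrightarrow> d \<in> tangent_pencil P c"
proof -
  have "card (c \<inter> d) = 1 \<longleftrightarrow> c \<inter> d = {P}"
    using assms by (metis IntI card_1_singletonE is_singletonI is_singleton_altdef singletonD)
  thus ?thesis using assms by (auto simp: touch_def tangent_pencil_def)
qed

lemma finite_tangent_pencil: "finite (tangent_pencil P c)"
  using finite_circles by (simp add: tangent_pencil_def)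

lemma tangent_pencil_subset:
  assumes "c \<in> circles" "P \<in> c" "d \<in> tangent_pencil P c"
  shows "tangent_pencil P d \<subseteq> tangent_pencil P c"
proof
  fix e assume e: "e \<in> tangent_pencil P d"
  have "c \<inter> e = {P}" if "c \<noteq> e" "d \<noteq> c" "d \<noteq> e"
  proof -
    have de: "d \<in> circles" "e \<in> circles" "P \<in> e" "d \<inter> c = {P}" "d \<inter> e = {P}"
      using that assms e by (auto simp: tangent_pencil_def)
    have "Q = P" if "Q \<in> c" "Q \<in> e" for Q
      using tangent_unique[of d c e Q P] de that assms \<open>c \<noteq> e\<close> by blast
    thus ?thesis using assms de by blast
  qed
  thus "e \<in> tangent_pencil P c" using assms e by (auto simp: tangent_pencil_def)
qed

lemma tangent_pencil_eq:
  assumes "c \<in> circles" "P \<in> c" "d \<in> tangent_pencil P c"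
  shows "tangent_pencil P d = tangent_pencil P c"
proof
  have "c \<in> tangent_pencil P d" "d \<in> circles" "P \<in> d"
    using assms by (auto simp: tangent_pencil_def)
  thus "tangent_pencil P c \<subseteq> tangent_pencil P d" using tangent_pencil_subset by blast
qed (rule tangent_pencil_subset[OF assms])

lemma tangent_pencil_ex1:
  assumes "c \<in> circles" "P \<in> c" "Q \<in> points" "Q \<noteq> P"
  shows "\<exists>!d. d \<in> tangent_pencil P c \<and> Q \<in> d"
proof (cases "Q \<in> c")
  case True
  thus ?thesis using assms by (intro ex1I[of _ c]) (auto simp: tangent_pencil_def)
next
  case False
  obtain d where d: "d \<in> circles" "Q \<in> d" "c \<inter> d = {P}"
    using tangent_exists[of c P Q] assms False by blast
  have uniq: "e = d" if "e \<in> circles" "Q \<in> e" "c \<inter> e = {P}" for e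
    using tangent_unique[of c e d Q P] that d assms by blast
  show ?thesis
  proof (rule ex1I[of _ d])
    show "d \<in> tangent_pencil P c \<and> Q \<in> d" using d unfolding tangent_pencil_def by blast
    show "e = d" if "e \<in> tangent_pencil P c \<and> Q \<in> e" for e
      using that uniq[of e] False unfolding tangent_pencil_def by blast
  qed
qed

lemma card_circles_in_pencil_through:
  assumes "c \<in> circles" "P \<in> c" "Q \<in> points" "Q \<noteq> P"
  shows "card {d \<in> tangent_pencil P c. Q \<in> d} = 1"
proof -
  obtain d where d: "d \<in> tangent_pencil P c" "Q \<in> d"
    and uniq: "\<And>e. e \<in> tangent_pencil P c \<Longrightarrow> Q \<in> e \<Longrightarrow> e = d"
    using tangent_pencil_ex1[OF assms] by blast
  have "{d \<in> tangent_pencil P c. Q \<in> d} = {d}" using d uniq by blast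
  thus ?thesis by simp
qed

lemma card_tangent_pencil:
  assumes "c \<in> circles" "P \<in> c"
  shows "card (tangent_pencil P c) = q"
proof -
  have P: "P \<in> points" using assms circles_sub by blast
  have "q * card (tangent_pencil P c) =
      (\<Sum>d\<in>tangent_pencil P c. card {Q \<in> points - {P}. Q \<in> d})"
  proof -
    have "card {Q \<in> points - {P}. Q \<in> d} = q" if "d \<in> tangent_pencil P c" for d
    proof -
      have "d \<in> circles" "P \<in> d" using that by (auto simp: tangent_pencil_def)
      moreover from this have "{Q \<in> points - {P}. Q \<in> d} = d - {P}" using circles_sub by blast
      ultimately show ?thesis using card_circle[of d] by simp
    qed
    thus ?thesis by simp
  qed
  also have "\<dots> = (\<Sum>Q\<in>points - {P}. card {d \<in> tangent_pencil P c. Q \<in> d})"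
    using finite_pts finite_tangent_pencil by (intro double_count) auto
  also have "\<dots> = (\<Sum>Q\<in>points - {P}. 1)"
    using card_circles_in_pencil_through[OF assms] by (intro sum.cong) auto
  also have "\<dots> = q * q" using card_points P finite_pts by (simp add: power2_eq_square)
  finally show ?thesis using order_ge_2 by simp
qed

text \<open>
  There is exactly one tangent through \<open>P\<close> for each point of contact.
\<close>

lemma card_tangents_through_exterior_point:
  assumes "d \<in> circles" "P \<in> points" "P \<notin> d"
  shows "card {x \<in> circles. P \<in> x \<and> touch x d} = q + 1"
proof -
  let ?X = "{x \<in> circles. P \<in> x \<and> touch x d}"
  have "\<exists>x. x \<in> circles \<and> P \<in> x \<and> d \<inter> x = {Q}" if "Q \<in> d" for Q
    using tangent_exists[of d Q P] that assms by blast
  then obtain f where f: "\<And>Q. Q \<in> d \<Longrightarrow> f Q \<in> circles \<and> P \<in> f Q \<and> d \<inter> f Q = {Q}"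
    by metis
  have "inj_on f d" using f by (intro inj_onI) (metis singleton_inject)
  moreover have "f ` d = ?X"
  proof
    show "f ` d \<subseteq> ?X" using f by (auto simp: touch_def Int_commute)
    show "?X \<subseteq> f ` d"
    proof
      fix x assume x: "x \<in> ?X"
      then obtain Q where Q: "d \<inter> x = {Q}"
        using assms by (auto simp: touch_def card_1_singleton_iff Int_commute)
      hence "Q \<in> d" by blast
      moreover have "x = f Q" using tangent_unique[of d x "f Q" P Q] x Q f[OF \<open>Q \<in> d\<close>] assms by blast
      ultimately show "x \<in> f ` d" by blast
    qed
  qed
  ultimately show ?thesis using card_circle[OF assms(1)] by (metis card_image)
qed

text \<open>
  If no member of the pencil touched \<open>d\<close>, all of them would meet \<open>d\<close> in an even number of
  points.  They partition \<open>d\<close>, whose size \<open>q + 1\<close> is odd.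
\<close>

lemma tangent_pencil_contains_tangent:
  assumes "even q" "c \<in> circles" "P \<in> c" "d \<in> circles" "P \<notin> d"
  shows "card {x \<in> tangent_pencil P c. touch x d} \<ge> 1"
proof (rule ccontr)
  assume "\<not> ?thesis"
  moreover have "finite {x \<in> tangent_pencil P c. touch x d}" using finite_tangent_pencil by simp
  ultimately have none: "\<not> touch x d" if "x \<in> tangent_pencil P c" for x using that
    by (metis (mono_tags, lifting) card_0_eq empty_iff less_one mem_Collect_eq not_less)
  have "even (card {Q \<in> d. Q \<in> x})" if x: "x \<in> tangent_pencil P c" for x
  proof -
    have "x \<in> circles" "x \<noteq> d" using x assms by (auto simp: tangent_pencil_def)
    hence "card (x \<inter> d) \<le> 2" "card (x \<inter> d) \<noteq> 1"
      using card_Int_le_2[of x d] assms none[OF x] by (auto simp: touch_def)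
    moreover have "{Q \<in> d. Q \<in> x} = x \<inter> d" by blast
    moreover have "n = 0 \<or> n = 2" if "n \<le> 2" "n \<noteq> 1" for n :: nat using that by auto
    ultimately show ?thesis by fastforce
  qed
  hence "even (\<Sum>x\<in>tangent_pencil P c. card {Q \<in> d. Q \<in> x})" by (intro dvd_sum)
  also have "(\<Sum>x\<in>tangent_pencil P c. card {Q \<in> d. Q \<in> x}) =
      (\<Sum>Q\<in>d. card {x \<in> tangent_pencil P c. Q \<in> x})"
    using finite_circle assms finite_tangent_pencil by (intro double_count) auto
  also have "\<dots> = (\<Sum>Q\<in>d. 1)"
    using card_circles_in_pencil_through[of c P] assms circles_sub by (intro sum.cong) auto
  also have "\<dots> = q + 1" using card_circle assms by simp
  finally show False using assms by simp
qed

text \<open>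
  The pencils at \<open>P\<close> are represented by the \<open>q + 1\<close> circles \<open>g\<close> through \<open>P\<close> and an auxiliary
  point \<open>Q\<close>.  They share the \<open>q + 1\<close> tangents to \<open>d\<close> through \<open>P\<close>, and each has at least one.
\<close>

lemma card_tangents_in_pencil:
  assumes "even q" "c \<in> circles" "P \<in> c" "d \<in> circles" "P \<notin> d"
  shows "card {x \<in> tangent_pencil P c. touch x d} = 1"
proof -
  have P: "P \<in> points" using assms circles_sub by blast
  obtain Q where "Q \<in> d" using circle_nonempty assms by blast
  hence Q: "Q \<in> points" "Q \<noteq> P" using assms circles_sub by blast+
  let ?G = "{g \<in> circles. P \<in> g \<and> Q \<in> g}"
  let ?X = "{x \<in> circles. P \<in> x \<and> touch x d}"
  let ?t = "\<lambda>g. card {x \<in> tangent_pencil P g. touch x d}"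
  have "(\<Sum>g\<in>?G. ?t g) = (\<Sum>g\<in>?G. card {x \<in> ?X. g \<in> tangent_pencil P x})"
  proof (intro sum.cong refl arg_cong[where f = card])
    fix g assume "g \<in> ?G"
    thus "{x \<in> tangent_pencil P g. touch x d} = {x \<in> ?X. g \<in> tangent_pencil P x}"
      by (auto simp: tangent_pencil_def Int_commute)
  qed
  also have "\<dots> = (\<Sum>x\<in>?X. card {g \<in> ?G. g \<in> tangent_pencil P x})"
    using finite_circles by (intro double_count) auto
  also have "\<dots> = (\<Sum>x\<in>?X. 1)"
  proof (intro sum.cong refl)
    fix x assume "x \<in> ?X"
    moreover have "{g \<in> ?G. g \<in> tangent_pencil P x} = {g \<in> tangent_pencil P x. Q \<in> g}"
      by (auto simp: tangent_pencil_def)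
    ultimately show "card {g \<in> ?G. g \<in> tangent_pencil P x} = 1"
      using card_circles_in_pencil_through[of x P Q] Q by simp
  qed
  also have "\<dots> = card ?G"
    using card_tangents_through_exterior_point[of d P] card_circles_through_2[of P Q] P Q assms
    by simp
  finally have "(\<Sum>g\<in>?G. ?t g) = (\<Sum>g\<in>?G. 1)" by simp
  moreover have "1 \<le> ?t g" if "g \<in> ?G" for g
    using tangent_pencil_contains_tangent[of g P d] that assms by blast
  ultimately have one: "?t g = 1" if "g \<in> ?G" for g
    using sum_mono_inv[of "\<lambda>_. 1" ?G ?t g] that finite_circles by simp
  obtain g where g: "g \<in> tangent_pencil P c" "Q \<in> g"
    using tangent_pencil_ex1[of c P Q] Q assms by blast
  hence "?t g = 1" by (intro one) (auto simp: tangent_pencil_def)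
  thus ?thesis using tangent_pencil_eq[OF assms(2,3) g(1)] by simp
qed

text \<open>
  Count the circles \<open>x\<close> touching \<open>e\<close> in the \<open>q + 1\<close> pencils of circles that touch \<open>d\<close> at one
  of its points.  The pencil at a point off \<open>e\<close> has exactly one.  The pencil at a common point of
  \<open>d\<close> and \<open>e\<close> consists of such circles if \<open>d\<close> touches \<open>e\<close> and has none otherwise, because
  touching at a fixed point is transitive.  The circle \<open>d\<close> is in all \<open>q + 1\<close> pencils, every
  other circle touching \<open>d\<close> in one.
\<close>

lemma card_common_tangents:
  assumes "even q" "d \<in> circles" "e \<in> circles"
  shows "card {x \<in> circles. touch x d \<and> touch x e} + card (d \<inter> e) =
    q + 1 + (if d = e then q\<^sup>2 else 0)"
proof -
  let ?T = "{x \<in> circles. touch x e}" and ?N = "{x \<in> circles. touch x d \<and> touch x e}"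
  have tp: "card {x \<in> tangent_pencil P d. touch x e} =
      of_bool (P \<notin> e) + (if P \<in> e \<and> touch d e then q else 0)" if P: "P \<in> d" for P
  proof (cases "P \<in> e")
    case False
    thus ?thesis using card_tangents_in_pencil assms P by simp
  next
    case True
    have mem: "touch x e \<longleftrightarrow> d \<in> tangent_pencil P e" if "x \<in> tangent_pencil P d" for x
    proof -
      have x: "x \<in> circles" "P \<in> x" using that by (auto simp: tangent_pencil_def)
      have "touch x e \<longleftrightarrow> e \<in> tangent_pencil P x"
        using touch_iff_pencil[of x e P] x True assms by blast
      also have "tangent_pencil P x = tangent_pencil P d"
        using tangent_pencil_eq that P assms by blast
      also have "e \<in> tangent_pencil P d \<longleftrightarrow> d \<in> tangent_pencil P e"
        using assms P True by (auto simp: tangent_pencil_def Int_commute)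
      finally show ?thesis .
    qed
    have "d \<in> tangent_pencil P e \<longleftrightarrow> touch d e"
      using touch_iff_pencil[of e d P] assms P True touch_sym by blast
    hence "{x \<in> tangent_pencil P d. touch x e} = (if touch d e then tangent_pencil P d else {})"
      using mem by auto
    thus ?thesis using True card_tangent_pencil[OF assms(2) P] by simp
  qed
  have "(\<Sum>P\<in>d. card {x \<in> tangent_pencil P d. touch x e}) =
      (\<Sum>P\<in>d. card {x \<in> ?T. x \<in> tangent_pencil P d})"
    by (intro sum.cong refl arg_cong[where f = card]) (auto simp: tangent_pencil_def)
  also have "\<dots> = (\<Sum>x\<in>?T. card {P \<in> d. x \<in> tangent_pencil P d})"
    using finite_circles finite_circle assms by (intro double_count) auto
  also have "\<dots> = (\<Sum>x\<in>?T. of_bool (touch x d) + (if x = d then q else 0))"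
  proof (intro sum.cong refl)
    fix x assume "x \<in> ?T"
    hence x: "x \<in> circles" by blast
    show "card {P \<in> d. x \<in> tangent_pencil P d} = of_bool (touch x d) + (if x = d then q else 0)"
    proof (cases "x = d")
      case True
      hence "{P \<in> d. x \<in> tangent_pencil P d} = d" using x by (auto simp: tangent_pencil_def)
      thus ?thesis using True card_circle x by (simp add: touch_def)
    next
      case False
      show ?thesis
      proof (cases "card (x \<inter> d) = 1")
        case True
        then obtain P where "x \<inter> d = {P}" by (auto simp: card_1_singleton_iff)
        hence "{P \<in> d. x \<in> tangent_pencil P d} = {P}"
          using x False by (auto simp: tangent_pencil_def)
        thus ?thesis using True False by (simp add: touch_def)
      next
        case no: False
        hence "d \<inter> x \<noteq> {P}" for P by (metis Int_commute is_singletonI is_singleton_altdef)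
        hence "{P \<in> d. x \<in> tangent_pencil P d} = {}"
          using x False by (auto simp: tangent_pencil_def)
        thus ?thesis using no False by (simp only: touch_def) simp
      qed
    qed
  qed
  also have "\<dots> = card ?N + (if touch d e then q else 0)"
  proof -
    have "(\<Sum>x\<in>?T. of_bool (touch x d)) = card ?N"
      using finite_circles by (auto simp: Int_def intro!: arg_cong[where f = card])
    moreover have "(\<Sum>x\<in>?T. if x = d then q else 0) = (if touch d e then q else 0)"
      using finite_circles assms by (simp add: sum.delta')
    ultimately show ?thesis by (simp add: sum.distrib)
  qed
  also have "(\<Sum>P\<in>d. card {x \<in> tangent_pencil P d. touch x e}) =
      card (d - e) + (if touch d e then q * card (d \<inter> e) else 0)"
  proof -
    have "(\<Sum>P\<in>d. card {x \<in> tangent_pencil P d. touch x e}) =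
      (\<Sum>P\<in>d. of_bool (P \<notin> e) + (if P \<in> e \<and> touch d e then q else 0))"
      using tp by (rule sum.cong[OF refl])
    also have "\<dots> = (\<Sum>P\<in>d. of_bool (P \<notin> e)) + (\<Sum>P\<in>d. if P \<in> e \<and> touch d e then q else 0)"
      by (rule sum.distrib)
    also have "(\<Sum>P\<in>d. of_bool (P \<notin> e)) = card (d - e)"
      using finite_circle[OF assms(2)] by (simp add: Int_def set_diff_eq)
    also have "(\<Sum>P\<in>d. if P \<in> e \<and> touch d e then q else 0) = 
        (if touch d e then q * card (d \<inter> e) else 0)"
      using finite_circle[OF assms(2)] by (simp flip: sum.inter_restrict)
    finally show ?thesis .
  qed
  finally have "card (d - e) + (if touch d e then q * card (d \<inter> e) else 0) =
    card ?N + (if touch d e then q else 0)" .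
  moreover have "card (d - e) + card (d \<inter> e) = q + 1"
    using card_circle[OF assms(2)] finite_circle[OF assms(2)] card_Int_Diff[of d e] by simp
  moreover have "card (d \<inter> e) = 1" if "touch d e" "d \<noteq> e" using that by (simp add: touch_def)
  ultimately show ?thesis using card_circle[OF assms(2)]
    by (cases "d = e"; cases "touch d e") (auto simp: touch_def power2_eq_square)
qed

lemma card_touching_through:
  assumes "d \<in> circles" "P \<in> points"
  shows "card {x \<in> circles. P \<in> x \<and> touch x d} + of_bool (P \<in> d) = q + 1"
proof (cases "P \<in> d")
  case True
  hence "{x \<in> circles. P \<in> x \<and> touch x d} = tangent_pencil P d"
    using touch_iff_pencil[of d _ P] touch_sym assms by (auto simp: tangent_pencil_def)
  thus ?thesis using True card_tangent_pencil assms by simp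
next
  case False
  thus ?thesis using card_tangents_through_exterior_point assms by simp
qed

end

section \<open>Quadratic identities for a family of circles\<close>

locale circle_family = moebius_plane_order +
  fixes F :: "'a set set"
  assumes family: "F \<subseteq> circles"
begin

definition deg :: "'a \<Rightarrow> real" where
  "deg P = card {c \<in> F. P \<in> c}"

definition weight :: "'a set \<Rightarrow> real" where
  "weight c = (\<Sum>P\<in>c. deg P)"

text \<open>
  A member \<open>c\<close> of \<open>F\<close> is included in its own count, so that this is the matrix of the touching
  relation applied to the indicator function of \<open>F\<close>.
\<close>

definition tangents :: "'a set \<Rightarrow> real" where
  "tangents c = card {d \<in> F. touch c d}"

definition sq_deg :: real where
  "sq_deg = (\<Sum>P\<in>points. (deg P)\<^sup>2)"

lemma finite_F: "finite F"
  using family finite_circles finite_subset by blast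

lemma sum_flags:
  fixes g :: "'a \<Rightarrow> 'a set \<Rightarrow> real"
  assumes "C \<subseteq> circles"
  shows "(\<Sum>c\<in>C. \<Sum>P\<in>c. g P c) = (\<Sum>P\<in>points. \<Sum>c\<in>{c\<in>C. P \<in> c}. g P c)"
proof -
  have fin: "finite C" using assms finite_circles finite_subset by blast
  have "(\<Sum>c\<in>C. \<Sum>P\<in>c. g P c) = (\<Sum>c\<in>C. \<Sum>P\<in>{P\<in>points. P \<in> c}. g P c)"
    using assms circles_sub by (intro sum.cong) auto
  also have "\<dots> = (\<Sum>P\<in>points. \<Sum>c\<in>{c\<in>C. P \<in> c}. g P c)"
    using fin finite_pts by (rule sum.swap_restrict)
  finally show ?thesis .
qed

lemma sum_deg: "(\<Sum>P\<in>points. deg P) = (q + 1) * card F"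
proof -
  have "(\<Sum>P\<in>points. deg P) = (\<Sum>c\<in>F. \<Sum>P\<in>c. 1)"
    by (simp only: sum_flags[OF family]) (simp add: deg_def)
  also have "\<dots> = (\<Sum>c\<in>F. real (q + 1))"
  proof (intro sum.cong refl)
    fix c assume "c \<in> F"
    thus "(\<Sum>P\<in>c. 1) = real (q + 1)" using card_circle[of c] family by auto
  qed
  finally show ?thesis by (simp add: algebra_simps)
qed

lemma sum_weight_family: "(\<Sum>c\<in>F. weight c) = sq_deg"
proof -
  have "(\<Sum>c\<in>F. weight c) = (\<Sum>P\<in>points. \<Sum>c\<in>{c\<in>F. P \<in> c}. deg P)"
    unfolding weight_def by (rule sum_flags[OF family])
  thus ?thesis by (simp add: sq_deg_def deg_def power2_eq_square)
qed

lemma sum_card_Int: "(\<Sum>d\<in>F. \<Sum>e\<in>F. real (card (d \<inter> e))) = sq_deg"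
proof -
  have "(\<Sum>e\<in>F. real (card (d \<inter> e))) = weight d" if "d \<in> F" for d
  proof -
    have "finite d" using that family finite_circle by blast
    hence "(\<Sum>e\<in>F. card {P \<in> d. P \<in> e}) = (\<Sum>P\<in>d. card {e \<in> F. P \<in> e})"
      by (rule double_count[OF finite_F])
    hence "(\<Sum>e\<in>F. real (card {P \<in> d. P \<in> e})) = weight d"
      unfolding weight_def deg_def by (simp flip: of_nat_sum)
    thus ?thesis by (simp add: Int_def)
  qed
  thus ?thesis using sum_weight_family by simp
qed

text \<open>
  A point \<open>Q\<close> is counted once for each circle through \<open>P\<close> and \<open>Q\<close>: \<open>q + 1\<close> times if it is
  different from \<open>P\<close>, and \<open>q (q + 1) = (q + 1) + (q\<^sup>2 - 1)\<close> times if \<open>Q = P\<close>.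
\<close>

lemma sum_weight_through:
  assumes "P \<in> points"
  shows "(\<Sum>c\<in>{c\<in>circles. P \<in> c}. weight c) = (real q + 1)\<^sup>2 * card F + ((real q)\<^sup>2 - 1) * deg P"
proof -
  let ?C = "{c\<in>circles. P \<in> c}"
  have "(\<Sum>c\<in>?C. weight c) = (\<Sum>Q\<in>points. \<Sum>c\<in>{c\<in>?C. Q \<in> c}. deg Q)"
    unfolding weight_def by (rule sum_flags) auto
  also have "\<dots> = (\<Sum>Q\<in>points. (real q + 1) * deg Q + (if Q = P then ((real q)\<^sup>2 - 1) * deg P else 0))"
  proof (intro sum.cong refl)
    fix Q assume Q: "Q \<in> points"
    show "(\<Sum>c\<in>{c\<in>?C. Q \<in> c}. deg Q) =
      (real q + 1) * deg Q + (if Q = P then ((real q)\<^sup>2 - 1) * deg P else 0)"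
    proof (cases "Q = P")
      case True
      hence "{c\<in>?C. Q \<in> c} = ?C" by blast
      thus ?thesis using True card_circles_through[OF assms]
        by (simp add: algebra_simps power2_eq_square)
    next
      case False
      thus ?thesis using card_circles_through_2[OF assms Q] by (simp add: conj_assoc add.commute)
    qed
  qed
  also have "\<dots> = (real q + 1) * (\<Sum>Q\<in>points. deg Q) + ((real q)\<^sup>2 - 1) * deg P"
    using finite_pts assms by (simp add: sum.distrib sum_distrib_left)
  finally show ?thesis using sum_deg by (simp add: power2_eq_square algebra_simps)
qed

lemma sum_weight: "(\<Sum>c\<in>circles. weight c) = q * (real q + 1)\<^sup>2 * card F"
proof -
  have "(\<Sum>c\<in>circles. weight c) = (\<Sum>P\<in>points. \<Sum>c\<in>{c\<in>circles. P \<in> c}. deg P)"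
    unfolding weight_def by (rule sum_flags) auto
  also have "\<dots> = (\<Sum>P\<in>points. real (q * (q + 1)) * deg P)"
    using card_circles_through by (intro sum.cong) auto
  also have "\<dots> = real (q * (q + 1)) * ((q + 1) * card F)"
    by (simp only: sum_distrib_left[symmetric] sum_deg)
  finally show ?thesis by (simp add: power2_eq_square algebra_simps)
qed

lemma sum_weight_mult:
  "(\<Sum>c\<in>circles. weight c * g c) = (\<Sum>P\<in>points. deg P * (\<Sum>c\<in>{c\<in>circles. P \<in> c}. g c))"
proof -
  have "(\<Sum>c\<in>circles. weight c * g c) = (\<Sum>c\<in>circles. \<Sum>P\<in>c. deg P * g c)"
    by (simp add: weight_def sum_distrib_right)
  also have "\<dots> = (\<Sum>P\<in>points. \<Sum>c\<in>{c\<in>circles. P \<in> c}. deg P * g c)"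
    by (rule sum_flags) auto
  finally show ?thesis by (simp add: sum_distrib_left)
qed

lemma sum_weight_squared:
  "(\<Sum>c\<in>circles. (weight c)\<^sup>2) = ((real q)\<^sup>2 - 1) * sq_deg + (real q + 1) ^ 3 * (card F)\<^sup>2"
proof -
  have "(\<Sum>c\<in>circles. (weight c)\<^sup>2) = (\<Sum>P\<in>points. deg P * (\<Sum>c\<in>{c\<in>circles. P \<in> c}. weight c))"
    using sum_weight_mult[of weight] by (simp add: power2_eq_square)
  also have "\<dots> = (\<Sum>P\<in>points. (real q + 1)\<^sup>2 * card F * deg P + ((real q)\<^sup>2 - 1) * (deg P)\<^sup>2)"
    by (intro sum.cong refl) (simp add: sum_weight_through algebra_simps power2_eq_square)
  also have "\<dots> = (real q + 1)\<^sup>2 * card F * (\<Sum>P\<in>points. deg P) + ((real q)\<^sup>2 - 1) * sq_deg"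
    by (simp add: sum.distrib sum_distrib_left sq_deg_def)
  finally show ?thesis by (simp add: sum_deg power2_eq_square power3_eq_cube algebra_simps)
qed

text \<open>
  A circle \<open>d\<close> is touched by \<open>q + 1\<close> of the circles through \<open>P\<close>, or by \<open>q\<close> of them if it
  contains \<open>P\<close>.
\<close>

lemma sum_tangents_through:
  assumes "P \<in> points"
  shows "(\<Sum>c\<in>{c\<in>circles. P \<in> c}. tangents c) = (real q + 1) * card F - deg P"
proof -
  let ?C = "{c\<in>circles. P \<in> c}"
  have "(\<Sum>c\<in>?C. card {d \<in> F. touch c d}) = (\<Sum>d\<in>F. card {c \<in> ?C. touch c d})"
    using finite_circles finite_F by (intro double_count) auto
  hence "(\<Sum>c\<in>?C. tangents c) = (\<Sum>d\<in>F. real (card {c \<in> ?C. touch c d}))"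
    unfolding tangents_def by (simp flip: of_nat_sum)
  also have "\<dots> = (\<Sum>d\<in>F. (real q + 1) - of_bool (P \<in> d))"
  proof (intro sum.cong refl)
    fix d assume "d \<in> F"
    hence "card {c \<in> ?C. touch c d} + of_bool (P \<in> d) = q + 1"
      using card_touching_through[of d P] assms family by (auto simp: conj_assoc)
    thus "real (card {c \<in> ?C. touch c d}) = (real q + 1) - of_bool (P \<in> d)"
      by (cases "P \<in> d") auto
  qed
  also have "\<dots> = (real q + 1) * card F - deg P"
    using finite_F by (simp add: sum_subtractf deg_def Int_def)
  finally show ?thesis .
qed

lemma sum_tangents: "(\<Sum>c\<in>circles. tangents c) = (real q)\<^sup>2 * card F"
proof -
  have "(real q + 1) * (\<Sum>c\<in>circles. tangents c) = (\<Sum>c\<in>circles. \<Sum>P\<in>c. tangents c)"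
    using card_circle by (simp add: sum_distrib_left add.commute)
  also have "\<dots> = (\<Sum>P\<in>points. \<Sum>c\<in>{c\<in>circles. P \<in> c}. tangents c)"
    by (rule sum_flags) auto
  also have "\<dots> = card points * ((real q + 1) * card F) - (\<Sum>P\<in>points. deg P)"
    by (simp add: sum_tangents_through sum_subtractf)
  also have "\<dots> = (real q + 1) * ((real q)\<^sup>2 * card F)"
    by (simp add: sum_deg card_points algebra_simps)
  finally show ?thesis by (metis add_cancel_right_left add_is_0 mult_left_cancel of_nat_0_eq_iff of_nat_1 of_nat_add zero_neq_one)
qed

lemma sum_weight_tangents:
  "(\<Sum>c\<in>circles. weight c * tangents c) = (real q + 1)\<^sup>2 * (card F)\<^sup>2 - sq_deg"
proof -
  have "(\<Sum>c\<in>circles. weight c * tangents c) =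
      (\<Sum>P\<in>points. (real q + 1) * card F * deg P - (deg P)\<^sup>2)"
    unfolding sum_weight_mult
    by (intro sum.cong refl) (simp add: sum_tangents_through algebra_simps power2_eq_square)
  also have "\<dots> = (real q + 1) * card F * (\<Sum>P\<in>points. deg P) - sq_deg"
    by (simp add: sum_subtractf sum_distrib_left sq_deg_def)
  finally show ?thesis by (simp add: sum_deg power2_eq_square algebra_simps)
qed

lemma sum_tangents_squared:
  assumes "even q"
  shows "(\<Sum>c\<in>circles. (tangents c)\<^sup>2) =
    (real q)\<^sup>2 * card F + (real q + 1) * (card F)\<^sup>2 - sq_deg"
proof -
  have tb: "tangents c = (\<Sum>d\<in>F. of_bool (touch c d))" for c
    using finite_F by (simp add: tangents_def Int_def)
  have "(\<Sum>c\<in>circles. (tangents c)\<^sup>2) =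
      (\<Sum>c\<in>circles. \<Sum>d\<in>F. \<Sum>e\<in>F. of_bool (touch c d \<and> touch c e))"
    by (simp add: tb power2_eq_square sum_product of_bool_conj)
  also have "\<dots> = (\<Sum>d\<in>F. \<Sum>c\<in>circles. \<Sum>e\<in>F. of_bool (touch c d \<and> touch c e))"
    by (rule sum.swap)
  also have "\<dots> = (\<Sum>d\<in>F. \<Sum>e\<in>F. \<Sum>c\<in>circles. of_bool (touch c d \<and> touch c e))"
    by (intro sum.cong refl sum.swap)
  also have "\<dots> = (\<Sum>d\<in>F. \<Sum>e\<in>F.
      (real q + 1) + (if d = e then (real q)\<^sup>2 else 0) - real (card (d \<inter> e)))"
  proof (intro sum.cong refl)
    fix d e assume "d \<in> F" "e \<in> F"
    hence "d \<in> circles" "e \<in> circles" using family by blast+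
    hence "real (card {x \<in> circles. touch x d \<and> touch x e} + card (d \<inter> e)) =
        real (q + 1 + (if d = e then q\<^sup>2 else 0))"
      by (simp only: card_common_tangents[OF assms])
    moreover have "(\<Sum>c\<in>circles. of_bool (touch c d \<and> touch c e)) = 
        real (card {x \<in> circles. touch x d \<and> touch x e})"
      using finite_circles by (simp add: Int_def)
    ultimately show "(\<Sum>c\<in>circles. of_bool (touch c d \<and> touch c e)) = 
      (real q + 1) + (if d = e then (real q)\<^sup>2 else 0) - real (card (d \<inter> e))"
      by (auto split: if_splits)
  qed
  also have "\<dots> = (\<Sum>d\<in>F. \<Sum>e\<in>F. (real q + 1)) + (\<Sum>d\<in>F. \<Sum>e\<in>F. if d = e then (real q)\<^sup>2 else 0)
      - (\<Sum>d\<in>F. \<Sum>e\<in>F. real (card (d \<inter> e)))"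
    by (simp only: sum_subtractf sum.distrib)
  also have "\<dots> = (real q)\<^sup>2 * card F + (real q + 1) * (card F)\<^sup>2 - sq_deg"
    unfolding sum_card_Int using finite_F by (simp add: power2_eq_square algebra_simps)
  finally show ?thesis .
qed

text \<open>
  For two members of an intersecting family, the number of common points is 1 if they are
  tangent, 2 if they are distinct and not tangent, and \<open>q + 1\<close> if they are equal; so the sum of
  the intersection sizes determines the number of touching pairs.
\<close>

lemma sum_tangents_family:
  assumes "intersecting F"
  shows "(\<Sum>c\<in>F. tangents c) = 2 * (card F)\<^sup>2 + real q * card F - sq_deg"
proof -
  have "(\<Sum>c\<in>F. tangents c) = (\<Sum>d\<in>F. \<Sum>e\<in>F. of_bool (touch d e))"
    using finite_F by (simp add: tangents_def Int_def)
  also have "\<dots> = (\<Sum>d\<in>F. \<Sum>e\<in>F. 2 + (if d = e then real q else 0) - real (card (d \<inter> e)))"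
  proof (intro sum.cong refl)
    fix d e assume de: "d \<in> F" "e \<in> F"
    show "of_bool (touch d e) = 2 + (if d = e then real q else 0) - real (card (d \<inter> e))"
    proof (cases "d = e")
      case True
      thus ?thesis using card_circle[of d] de family by (auto simp: touch_def)
    next
      case False
      hence "d \<inter> e \<noteq> {}" using assms de by (auto simp: intersecting_def pairwise_def)
      moreover have "finite (d \<inter> e)" using de family finite_circle by blast
      ultimately have "card (d \<inter> e) \<noteq> 0" by simp
      moreover have "card (d \<inter> e) \<le> 2" using card_Int_le_2[of d e] de family False by blast
      ultimately have "card (d \<inter> e) = 1 \<or> card (d \<inter> e) = 2" by linarith
      thus ?thesis using False by (auto simp: touch_def)
    qed
  qed
  also have "\<dots> = (\<Sum>d\<in>F. \<Sum>e\<in>F. 2) + (\<Sum>d\<in>F. \<Sum>e\<in>F. if d = e then real q else 0)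
      - (\<Sum>d\<in>F. \<Sum>e\<in>F. real (card (d \<inter> e)))"
    by (simp only: sum_subtractf sum.distrib)
  also have "\<dots> = 2 * (card F)\<^sup>2 + real q * card F - sq_deg"
    unfolding sum_card_Int using finite_F by (simp add: power2_eq_square algebra_simps)
  finally show ?thesis .
qed

lemma sum_of_bool_family: "(\<Sum>c\<in>circles. of_bool (c \<in> F) * g c) = (\<Sum>c\<in>F. g c :: real)"
proof -
  have "(\<Sum>c\<in>F. g c) = (\<Sum>c\<in>circles. if c \<in> F then g c else 0)"
    using finite_circles family by (simp flip: sum.inter_restrict add: Int_absorb1)
  also have "\<dots> = (\<Sum>c\<in>circles. of_bool (c \<in> F) * g c)"
    by (intro sum.cong) auto
  finally show ?thesis by simp
qed

text \<open>
  The term that is squared is \<open>-(q\<^sup>2 - 1) g\<close>, where \<open>g\<close> is the projection of the indicator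
  function of \<open>F\<close> to the functions on circles whose sum over the circles through any point
  vanishes.  The constant \<open>card F * (q + 1) / q\<close> makes the terms sum to zero.
\<close>

lemma sum_point_deviation_squared:
  "(\<Sum>c\<in>circles. (weight c - ((real q)\<^sup>2 - 1) * of_bool (c \<in> F) - card F * (real q + 1) / q)\<^sup>2) =
    ((real q)\<^sup>2 - 1) * ((card F)\<^sup>2 * (real q + 1) / q + ((real q)\<^sup>2 - 1) * card F - sq_deg)"
  (is "(\<Sum>c\<in>circles. (?y c)\<^sup>2) = _")
proof -
  let ?r = "(real q)\<^sup>2 - 1"
  define k where "k = card F * (real q + 1) / q"
  have q: "real q > 0" using order_ge_2 by simp
  have "(weight c - ?r * of_bool (c \<in> F) - k)\<^sup>2 = (weight c)\<^sup>2
      - 2 * ?r * (of_bool (c \<in> F) * weight c)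
      + (?r\<^sup>2 + 2 * ?r * k) * (of_bool (c \<in> F) * 1) - 2 * k * weight c + k\<^sup>2" for c
    by (cases "c \<in> F") (simp_all add: power2_eq_square algebra_simps)
  hence "(\<Sum>c\<in>circles. (?y c)\<^sup>2) = (\<Sum>c\<in>circles. (weight c)\<^sup>2 - 2 * ?r * (of_bool (c \<in> F) * weight c)
      + (?r\<^sup>2 + 2 * ?r * k) * (of_bool (c \<in> F) * 1) - 2 * k * weight c + k\<^sup>2)"
    by (simp only: k_def)
  also have "\<dots> = (\<Sum>c\<in>circles. (weight c)\<^sup>2) - 2 * ?r * (\<Sum>c\<in>F. weight c)
      + (?r\<^sup>2 + 2 * ?r * k) * card F - 2 * k * (\<Sum>c\<in>circles. weight c) + card circles * k\<^sup>2"
    by (simp only: sum.distrib sum_subtractf sum_distrib_left[symmetric] sum_of_bool_family) simp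
  also have "\<dots> = ?r * ((card F)\<^sup>2 * (real q + 1) / q + ?r * card F - sq_deg)"
    unfolding sum_weight_squared sum_weight_family sum_weight card_circles k_def using q
    by (simp add: field_simps power2_eq_square power3_eq_cube)
  finally show ?thesis .
qed

text \<open>
  With the same \<open>g\<close>, the term that is squared is \<open>(q - 1) (A g - q g)\<close> for the matrix \<open>A\<close> of
  the touching relation.  On these functions \<open>A\<close> can only have the eigenvalues \<open>q\<close> and \<open>-q\<close>;
  nonnegativity of the sum therefore says that \<open>q\<close> is the larger one.
\<close>

lemma sum_tangent_deviation_squared:
  assumes "even q" "intersecting F"
  shows "(\<Sum>c\<in>circles. ((real q - 1) * (tangents c - q * of_bool (c \<in> F)) + weight c - 2 * card F)\<^sup>2) =
    2 * real q * (real q - 1) * (real q - 2) * (sq_deg - 2 * (card F)\<^sup>2)"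
  (is "(\<Sum>c\<in>circles. (?z c)\<^sup>2) = _")
proof -
  let ?k = "2 * real (card F)" and ?r = "real q - 1"
  have "(\<Sum>c\<in>circles. (?z c)\<^sup>2) = (\<Sum>c\<in>circles. ?r\<^sup>2 * (tangents c)\<^sup>2
      - 2 * q * ?r\<^sup>2 * (of_bool (c \<in> F) * tangents c)
      + ((q * ?r)\<^sup>2 + 2 * ?k * q * ?r) * (of_bool (c \<in> F) * 1)
      + 2 * ?r * (weight c * tangents c) - 2 * q * ?r * (of_bool (c \<in> F) * weight c)
      + (weight c)\<^sup>2 - 2 * ?k * ?r * tangents c - 2 * ?k * weight c + ?k\<^sup>2)"
    by (intro sum.cong refl) (auto simp: power2_eq_square algebra_simps)
  also have "\<dots> = ?r\<^sup>2 * (\<Sum>c\<in>circles. (tangents c)\<^sup>2)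
      - 2 * q * ?r\<^sup>2 * (\<Sum>c\<in>F. tangents c)
      + ((q * ?r)\<^sup>2 + 2 * ?k * q * ?r) * card F
      + 2 * ?r * (\<Sum>c\<in>circles. weight c * tangents c) - 2 * q * ?r * (\<Sum>c\<in>F. weight c)
      + (\<Sum>c\<in>circles. (weight c)\<^sup>2) - 2 * ?k * ?r * (\<Sum>c\<in>circles. tangents c)
      - 2 * ?k * (\<Sum>c\<in>circles. weight c) + card circles * ?k\<^sup>2"
    by (simp only: sum.distrib sum_subtractf sum_distrib_left[symmetric] sum_of_bool_family) simp
  also have "\<dots> = 2 * real q * ?r * (real q - 2) * (sq_deg - 2 * (card F)\<^sup>2)"
    unfolding sum_tangents_squared[OF assms(1)] sum_tangents_family[OF assms(2)]
      sum_weight_tangents sum_weight_family sum_weight_squared sum_tangents sum_weight card_circles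
    by (simp add: power2_eq_square power3_eq_cube algebra_simps)
  finally show ?thesis .
qed

section \<open>The bound and the extremal families\<close>

lemma sq_deg_upper:
  "sq_deg \<le> (card F)\<^sup>2 * (real q + 1) / q + ((real q)\<^sup>2 - 1) * card F"
proof -
  have "(real q)\<^sup>2 - 1 > 0" using order_ge_2 by (simp add: one_less_power)
  moreover have "0 \<le> ((real q)\<^sup>2 - 1) *
      ((card F)\<^sup>2 * (real q + 1) / q + ((real q)\<^sup>2 - 1) * card F - sq_deg)"
    by (subst sum_point_deviation_squared[symmetric]) (intro sum_nonneg zero_le_power2)
  ultimately show ?thesis by (simp add: zero_le_mult_iff)
qed

lemma sq_deg_lower:
  assumes "even q" "q > 2" "intersecting F"
  shows "2 * (card F)\<^sup>2 \<le> sq_deg"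
proof -
  have "2 * real q * (real q - 1) * (real q - 2) > 0" using assms by simp
  moreover have "0 \<le> 2 * real q * (real q - 1) * (real q - 2) * (sq_deg - 2 * (card F)\<^sup>2)"
    by (subst sum_tangent_deviation_squared[OF assms(1,3), symmetric])
      (intro sum_nonneg zero_le_power2)
  ultimately show ?thesis by (simp add: zero_le_mult_iff)
qed

lemma card_family_le:
  assumes "even q" "q > 2" "intersecting F"
  shows "card F \<le> q * (q + 1)"
proof (cases "card F = 0")
  case False
  let ?m = "real (card F)"
  have m: "?m > 0" using False by simp
  have q: "real q > 1" using assms by simp
  have "2 * ?m\<^sup>2 \<le> ?m\<^sup>2 * (real q + 1) / q + ((real q)\<^sup>2 - 1) * ?m"
    using order_trans[OF sq_deg_lower[OF assms] sq_deg_upper] by simp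
  hence "(?m * (real q - 1)) * ?m \<le> (real q * (real q + 1) * (real q - 1)) * ?m"
    using q by (simp add: field_simps power2_eq_square)
  hence "?m * (real q - 1) \<le> (real q * (real q + 1)) * (real q - 1)"
    using m by (simp only: mult_le_cancel_right) simp
  hence "?m \<le> real q * (real q + 1)"
    using q by (simp add: mult_le_cancel_right)
  hence "real (card F) \<le> real (q * (q + 1))" by (simp add: algebra_simps)
  thus ?thesis by (simp only: of_nat_le_iff)
qed simp

text \<open>
  For \<open>card F = q (q + 1)\<close> the lower and the upper bound for \<open>sq_deg\<close> coincide, so the sum of
  squares behind the upper bound vanishes term by term.
\<close>

lemma weight_of_extremal:
  assumes "even q" "q > 2" "intersecting F" "card F = q * (q + 1)" "c \<in> circles"
  shows "weight c = (real q + 1)\<^sup>2 + ((real q)\<^sup>2 - 1) * of_bool (c \<in> F)"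
proof -
  let ?m = "real (card F)"
  let ?y = "\<lambda>c. weight c - ((real q)\<^sup>2 - 1) * of_bool (c \<in> F) - ?m * (real q + 1) / q"
  have q: "real q > 1" using assms by simp
  have m: "?m = real q * (real q + 1)" using assms(4) by (simp add: algebra_simps)
  have "2 * ?m\<^sup>2 = ?m\<^sup>2 * (real q + 1) / q + ((real q)\<^sup>2 - 1) * ?m"
    unfolding m using q by (simp add: field_simps) (simp add: power2_eq_square algebra_simps)
  hence "sq_deg = ?m\<^sup>2 * (real q + 1) / q + ((real q)\<^sup>2 - 1) * ?m"
    using sq_deg_lower[OF assms(1-3)] sq_deg_upper by simp
  hence "(\<Sum>c\<in>circles. (?y c)\<^sup>2) = 0"
    unfolding sum_point_deviation_squared by simp
  hence "\<forall>c\<in>circles. (?y c)\<^sup>2 = 0"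
    by (subst (asm) sum_nonneg_eq_0_iff) (simp_all add: finite_circles)
  hence "?y c = 0" using assms(5) by simp
  moreover have "?m * (real q + 1) / q = (real q + 1)\<^sup>2"
    unfolding m using q by (simp add: power2_eq_square)
  ultimately show ?thesis by simp
qed

lemma sum_weight_through_2:
  assumes "P \<in> points" "Q \<in> points" "P \<noteq> Q"
  shows "(\<Sum>c\<in>{c\<in>circles. P \<in> c \<and> Q \<in> c}. weight c) =
    (real q + 1) * card F + q * (deg P + deg Q)"
proof -
  let ?C = "{c\<in>circles. P \<in> c \<and> Q \<in> c}"
  have "(\<Sum>c\<in>?C. weight c) = (\<Sum>R\<in>points. \<Sum>c\<in>{c\<in>?C. R \<in> c}. deg R)"
    unfolding weight_def by (rule sum_flags) auto
  also have "\<dots> = (\<Sum>R\<in>points. deg R + (if R = P then q * deg P else 0) + (if R = Q then q * deg Q else 0))"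
  proof (intro sum.cong refl)
    fix R assume R: "R \<in> points"
    have "card {c\<in>?C. R \<in> c} = (if R = P \<or> R = Q then q + 1 else 1)"
    proof (cases "R = P \<or> R = Q")
      case True
      hence "{c\<in>?C. R \<in> c} = ?C" by blast
      thus ?thesis using True card_circles_through_2[OF assms] by simp
    next
      case False
      obtain c where c: "c \<in> circles" "P \<in> c" "Q \<in> c" "R \<in> c"
        using circle_exists[of P Q R] assms R False by blast
      have "d = c" if "d \<in> circles" "P \<in> d" "Q \<in> d" "R \<in> d" for d
        using circle_eqI[of d c P Q R] that c assms False by blast
      hence "{c\<in>?C. R \<in> c} = {c}" using c by blast
      thus ?thesis using False by simp
    qed
    thus "(\<Sum>c\<in>{c\<in>?C. R \<in> c}. deg R) =
      deg R + (if R = P then q * deg P else 0) + (if R = Q then q * deg Q else 0)"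
      using assms(3) by (auto simp: algebra_simps)
  qed
  also have "\<dots> = (\<Sum>R\<in>points. deg R) + q * deg P + q * deg Q"
    using finite_pts assms by (simp add: sum.distrib)
  finally show ?thesis using sum_deg by (simp add: algebra_simps)
qed

text \<open>
  Let \<open>l\<close> be the number of members of \<open>F\<close> through \<open>P\<close> and \<open>Q\<close>.  Evaluating the sum of the
  weights of all \<open>q + 1\<close> circles through \<open>P\<close> and \<open>Q\<close> in two ways expresses \<open>q\<close> times the sum
  of the two degrees by \<open>l\<close>.  Divisibility by \<open>q\<close> forces \<open>l\<close> to be 1 modulo \<open>q\<close>, hence
  \<open>l = 1\<close> or \<open>l = q + 1\<close>.
\<close>

lemma deg_sum_of_extremal:
  assumes "even q" "q > 2" "intersecting F" "card F = q * (q + 1)"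
    and PQ: "P \<in> points" "Q \<in> points" "P \<noteq> Q"
  shows "card {c \<in> F. P \<in> c} + card {c \<in> F. Q \<in> c} \<in> {2 * (q + 1), (q + 1)\<^sup>2}"
proof -
  let ?C = "{c\<in>circles. P \<in> c \<and> Q \<in> c}" and ?L = "{c\<in>F. P \<in> c \<and> Q \<in> c}"
  let ?s = "card {c \<in> F. P \<in> c} + card {c \<in> F. Q \<in> c}"
  define l where "l = card ?L"
  have "(real q + 1) * card F + q * (deg P + deg Q) = (\<Sum>c\<in>?C. weight c)"
    using sum_weight_through_2 PQ by simp
  also have "\<dots> = (\<Sum>c\<in>?C. (real q + 1)\<^sup>2 + ((real q)\<^sup>2 - 1) * of_bool (c \<in> F))"
    using weight_of_extremal[OF assms(1-4)] by (intro sum.cong) auto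
  also have "\<dots> = (real q + 1) ^ 3 + ((real q)\<^sup>2 - 1) * l"
  proof -
    have "{c \<in> circles. P \<in> c \<and> Q \<in> c} \<inter> {c. c \<in> F} = ?L" using family by blast
    hence "(\<Sum>c\<in>?C. of_bool (c \<in> F)) = real l" using finite_circles by (simp add: l_def)
    thus ?thesis using card_circles_through_2[OF PQ]
      by (simp only: sum.distrib sum_distrib_left[symmetric])
        (simp add: power2_eq_square power3_eq_cube algebra_simps)
  qed
  finally have "(real q + 1) * card F + q * (deg P + deg Q) =
    (real q + 1) ^ 3 + ((real q)\<^sup>2 - 1) * l" .
  hence "real (q * ?s + l) = real ((q + 1)\<^sup>2 + q\<^sup>2 * l)"
    using assms(4) by (simp add: deg_def power2_eq_square power3_eq_cube algebra_simps)
  hence eq: "q * ?s + l = (q + 1)\<^sup>2 + q\<^sup>2 * l" by (simp only: of_nat_eq_iff)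
  have "l \<le> card ?C" unfolding l_def using family finite_circles by (intro card_mono) auto
  hence le: "l \<le> q + 1" using card_circles_through_2[OF PQ] by simp
  have "l mod q = (q * ?s + l) mod q" by simp
  also have "\<dots> = (1 + q * (q + 2 + q * l)) mod q" unfolding eq
    by (simp add: power2_eq_square algebra_simps)
  also have "\<dots> = 1" unfolding mod_mult_self2 using assms(2) by simp
  finally have "l mod q = 1" .
  hence "l = 1 \<or> l = q + 1"
    using le assms(2) by (cases "l < q") (auto simp: le_Suc_eq not_less)
  thus ?thesis
  proof
    assume "l = 1"
    hence "q * ?s = q * (2 * (q + 1))" using eq by (simp add: power2_eq_square)
    thus ?thesis using assms(2) by (simp only: mult_cancel1) auto
  next
    assume "l = q + 1"
    hence "q * ?s = q * (q + 1)\<^sup>2" using eq by (simp add: power2_eq_square algebra_simps)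
    thus ?thesis using assms(2) by (simp only: mult_cancel1) auto
  qed
qed

text \<open>
  Not all degrees are \<open>q + 1\<close>, since their average is too large.  Take \<open>P\<close> with another degree and
  two more points \<open>Q\<close> and \<open>R\<close>.  Of the three pairwise sums of degrees an even number is odd, so
  an even number is equal to the odd number \<open>(q + 1)\<^sup>2\<close>, the others being \<open>2 (q + 1)\<close>.  If there
  were none, or if one of the two involved \<open>Q\<close> and \<open>R\<close>, then \<open>P\<close> would have degree \<open>q + 1\<close>.
  So \<open>Q\<close> and \<open>R\<close> have degree \<open>q + 1\<close> and \<open>P\<close> has degree \<open>(q + 1)\<^sup>2 - (q + 1)\<close>.
\<close>

lemma extremal_is_point_pencil:
  assumes "even q" "q > 2" "intersecting F" "card F = q * (q + 1)"
  shows "\<exists>P\<in>points. F = {c \<in> circles. P \<in> c}"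
proof -
  let ?a = "\<lambda>P. card {c \<in> F. P \<in> c}"
  have "\<exists>P\<in>points. ?a P \<noteq> q + 1"
  proof (rule ccontr)
    assume "\<not> ?thesis"
    hence "(\<Sum>P\<in>points. deg P) = (\<Sum>P\<in>points. real (q + 1))"
      by (intro sum.cong refl) (auto simp: deg_def)
    hence "real ((q + 1) * (q * (q + 1))) = real ((q + 1) * (q\<^sup>2 + 1))"
      unfolding sum_deg assms(4) by (simp add: card_points algebra_simps)
    hence "(q + 1) * (q * (q + 1)) = (q + 1) * (q\<^sup>2 + 1)" by (simp only: of_nat_eq_iff)
    hence "q * (q + 1) = q\<^sup>2 + 1" by (simp only: mult_cancel1) simp
    thus False using assms(2) by (simp add: power2_eq_square)
  qed
  then obtain P where P: "P \<in> points" "?a P \<noteq> q + 1" by blast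
  have "card (points - {P}) = q * q" using card_points P(1) by (simp add: power2_eq_square)
  moreover have "2 * 2 \<le> q * q" using assms(2) by (intro mult_le_mono) auto
  ultimately have "2 \<le> card (points - {P})" by linarith
  then obtain A where "A \<subseteq> points - {P}" "card A = 2" by (rule obtain_subset_with_card_n)
  then obtain Q R where QR: "Q \<in> points" "R \<in> points" "Q \<noteq> P" "R \<noteq> P" "Q \<noteq> R"
    by (auto simp: card_2_iff)
  (* Hiding the square leaves a statement on three pairwise sums that is linear. *)
  define u where "u = (q + 1)\<^sup>2"
  have "odd u" using assms(1) by (simp add: u_def)
  moreover have "?a P + ?a Q = 2 * (q + 1) \<or> ?a P + ?a Q = u"
      "?a P + ?a R = 2 * (q + 1) \<or> ?a P + ?a R = u" "?a Q + ?a R = 2 * (q + 1) \<or> ?a Q + ?a R = u"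
    using deg_sum_of_extremal[OF assms] P QR by (auto simp: u_def)
  moreover have "x + v = u"
    if "odd u" "x + y = 2 * v \<or> x + y = u" "x + z = 2 * v \<or> x + z = u"
      "y + z = 2 * v \<or> y + z = u" "x \<noteq> v" for x y z u v :: nat
    using that(2-5)
  proof (elim disjE)
    assume "x + y = u" "x + z = u" "y + z = u"
    hence "u = 2 * x" by linarith
    thus ?thesis using \<open>odd u\<close> by simp
  next
    assume "x + y = 2 * v" "x + z = 2 * v" "y + z = u"
    hence "u = 2 * y" by linarith
    thus ?thesis using \<open>odd u\<close> by simp
  next
    assume "x + y = 2 * v" "x + z = u" "y + z = 2 * v"
    hence "u = 2 * x" by linarith
    thus ?thesis using \<open>odd u\<close> by simp
  next
    assume "x + y = u" "x + z = 2 * v" "y + z = 2 * v"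
    hence "u = 2 * x" by linarith
    thus ?thesis using \<open>odd u\<close> by simp
  qed linarith+
  ultimately have "?a P + (q + 1) = u" using P(2) by blast
  hence a: "?a P = q * (q + 1)" by (simp add: u_def power2_eq_square)
  let ?B = "{c \<in> circles. P \<in> c}"
  have "{c \<in> F. P \<in> c} = F"
    using a assms(4) finite_F by (intro card_subset_eq) auto
  hence "F \<subseteq> ?B" using family by blast
  moreover have "card F = card ?B" using card_circles_through[OF P(1)] assms(4) by simp
  ultimately have "F = ?B" using finite_circles by (intro card_subset_eq) auto
  thus ?thesis using P(1) by blast
qed

end

theorem theorem1p3:
  fixes points :: "'a set" and circles F :: "'a set set" and q :: nat
  assumes "moebius_plane_of_order points circles q"
    and "even q" and "q > 2"
    and "F \<subseteq> circles" and "intersecting F"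
  shows "card F \<le> q * (q + 1) \<and>
    (card F = q * (q + 1) \<longleftrightarrow> (\<exists>P\<in>points. F = {c \<in> circles. P \<in> c}))"
proof -
  interpret circle_family points circles q F
    using assms by unfold_locales
  have "card F = q * (q + 1)" if "\<exists>P\<in>points. F = {c \<in> circles. P \<in> c}"
    using that card_circles_through by blast
  thus ?thesis using card_family_le extremal_is_point_pencil assms by blast
qed

end
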